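(* Let $m\ge 2$ and let $H$ be the free abelian group of rank $n$ with basis $\overline{x_1},\dots,\overline{x_n}$. The classes modulo $\mathfrak{J}_H^2$ of the elements of $$\overline{T_1}=\{s_{ij}(\overline{x_l})\mid 1\le i,j\le m,\ (i,j)\ne(m,m),\ 1\le l\le n\}$$ form a basis of $\mathrm{gr}^1(\mathfrak{J}_H)=\mathfrak{J}_H/\mathfrak{J}_H^2$ as a $\mathbf{Q}$-vector space.
   Context: Let $R^m(H)=\mathrm{Hom}(H,\mathrm{SL}(m,\mathbf{C}))$. For $x\in H$ and $1\le i,j\le m$, let $a_{ij}(x):R^m(H)\to\mathbf{C}$ be the function $\rho\mapsto$ the $(i,j)$-component of $\rho(x)$. Let $\mathfrak{R}^m_{\mathbf{Q}}(H)$ be the $\mathbf{Q}$-subalgebra of the algebra of all functions $R^m(H)\to\mathbf{C}$ (pointwise operations) generated by all $a_{ij}(x)$, $x\in H$, $1\le i,j\le m$. Put $s_{ij}(x)=a_{ij}(x)-\delta_{ij}$ ($\delta$ the Kronecker delta), and let $\mathfrak{J}_H$ be the ideal of $\mathfrak{R}^m_{\mathbf{Q}}(H)$ generated by $s_{ij}(\overline{x_l})$ for $1\le i,j\le m$, $1\le l\le n$. *)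

theory Defs
  imports
    "HOL-Algebra.Free_Abelian_Groups"
    "HOL-Algebra.Subrings"
    "HOL-Algebra.Ideal_Product"
    "HOL-Algebra.QuotRing"
    "Jordan_Normal_Form.Determinant"
    "Jordan_Normal_Form.VS_Connect"
begin

definition free_abelian_basis :: "('h, 'b) monoid_scheme \<Rightarrow> 'i set \<Rightarrow> ('i \<Rightarrow> 'h) \<Rightarrow> bool" where
  "free_abelian_basis H I x \<longleftrightarrow>
     comm_group H \<and> (\<exists>\<phi> \<in> iso (free_Abelian_group I) H. \<forall>i\<in>I. \<phi> (frag_of i) = x i)"

definition SL :: "nat \<Rightarrow> complex mat monoid" where
  "SL m = \<lparr>carrier = {A \<in> carrier_mat m m. det A = 1}, mult = (*), one = 1\<^sub>m m\<rparr>"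

text \<open>\<^const>\<open>hom\<close> does not constrain its members outside the carrier of the domain; extensionality
  ensures that each homomorphism is represented by exactly one HOL function. Functions on the
  representation set are made extensional for the same reason.\<close>

definition rep_set :: "('h, 'b) monoid_scheme \<Rightarrow> nat \<Rightarrow> ('h \<Rightarrow> complex mat) set" where
  "rep_set H m = hom H (SL m) \<inter> extensional (carrier H)"

definition fun_ring :: "'x set \<Rightarrow> ('x \<Rightarrow> complex) ring" where
  "fun_ring X = \<lparr>carrier = extensional X,
     mult = (\<lambda>f g. \<lambda>p\<in>X. f p * g p), one = (\<lambda>p\<in>X. 1),
     zero = (\<lambda>p\<in>X. 0), add = (\<lambda>f g. \<lambda>p\<in>X. f p + g p)\<rparr>"

definition rat_const :: "'x set \<Rightarrow> rat \<Rightarrow> 'x \<Rightarrow> complex" where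
  "rat_const X q = (\<lambda>p\<in>X. of_rat q)"

definition rat_subalgebra :: "'x set \<Rightarrow> ('x \<Rightarrow> complex) set \<Rightarrow> bool" where
  "rat_subalgebra X V \<longleftrightarrow> subring V (fun_ring X) \<and>
     (\<forall>q. \<forall>f\<in>V. rat_const X q \<otimes>\<^bsub>fun_ring X\<^esub> f \<in> V)"

definition rat_algebra_generated :: "'x set \<Rightarrow> ('x \<Rightarrow> complex) set \<Rightarrow> ('x \<Rightarrow> complex) set" where
  "rat_algebra_generated X S = \<Inter>{V. rat_subalgebra X V \<and> S \<subseteq> V}"

text \<open>Matrix indices of \<^typ>\<open>complex mat\<close> start at 0; the indices \<open>i\<close>, \<open>j\<close> below
  range over \<open>1, \<dots>, m\<close>.\<close>

definition coord :: "('h, 'b) monoid_scheme \<Rightarrow> nat \<Rightarrow> nat \<Rightarrow> nat \<Rightarrow> 'h \<Rightarrow>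
    ('h \<Rightarrow> complex mat) \<Rightarrow> complex" where
  "coord H m i j y = (\<lambda>\<rho>\<in>rep_set H m. \<rho> y $$ (i - 1, j - 1))"

definition s_coord :: "('h, 'b) monoid_scheme \<Rightarrow> nat \<Rightarrow> nat \<Rightarrow> nat \<Rightarrow> 'h \<Rightarrow>
    ('h \<Rightarrow> complex mat) \<Rightarrow> complex" where
  "s_coord H m i j y = (\<lambda>\<rho>\<in>rep_set H m. coord H m i j y \<rho> - (if i = j then 1 else 0))"

definition rep_ring :: "('h, 'b) monoid_scheme \<Rightarrow> nat \<Rightarrow> (('h \<Rightarrow> complex mat) \<Rightarrow> complex) ring" where
  "rep_ring H m = (fun_ring (rep_set H m))\<lparr>carrier :=
     rat_algebra_generated (rep_set H m)
       {coord H m i j y | i j y. i \<in> {1..m} \<and> j \<in> {1..m} \<and> y \<in> carrier H}\<rparr>"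

definition J_ideal :: "('h, 'b) monoid_scheme \<Rightarrow> nat \<Rightarrow> nat \<Rightarrow> (nat \<Rightarrow> 'h) \<Rightarrow>
    (('h \<Rightarrow> complex mat) \<Rightarrow> complex) set" where
  "J_ideal H m n x = Idl\<^bsub>rep_ring H m\<^esub>
     {s_coord H m i j (x l) | i j l. i \<in> {1..m} \<and> j \<in> {1..m} \<and> l \<in> {1..n}}"

definition J_squared :: "('h, 'b) monoid_scheme \<Rightarrow> nat \<Rightarrow> nat \<Rightarrow> (nat \<Rightarrow> 'h) \<Rightarrow>
    (('h \<Rightarrow> complex mat) \<Rightarrow> complex) set" where
  "J_squared H m n x = J_ideal H m n x \<cdot>\<^bsub>rep_ring H m\<^esub> J_ideal H m n x"

definition J_class :: "('h, 'b) monoid_scheme \<Rightarrow> nat \<Rightarrow> nat \<Rightarrow> (nat \<Rightarrow> 'h) \<Rightarrow>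
    (('h \<Rightarrow> complex mat) \<Rightarrow> complex) \<Rightarrow> (('h \<Rightarrow> complex mat) \<Rightarrow> complex) set" where
  "J_class H m n x f = J_squared H m n x +>\<^bsub>rep_ring H m\<^esub> f"

text \<open>The fields \<open>mult\<close> and \<open>one\<close> are inherited by the record type of modules from that of rings
  and play no role for a module.\<close>

definition gr1 :: "('h, 'b) monoid_scheme \<Rightarrow> nat \<Rightarrow> nat \<Rightarrow> (nat \<Rightarrow> 'h) \<Rightarrow>
    (rat, (('h \<Rightarrow> complex mat) \<Rightarrow> complex) set) module" where
  "gr1 H m n x = \<lparr>carrier = J_class H m n x ` J_ideal H m n x,
     mult = undefined, one = undefined,
     zero = J_squared H m n x,
     add = set_add (rep_ring H m),
     smult = (\<lambda>q A. \<Union>f\<in>A. J_class H m n x (rat_const (rep_set H m) q \<otimes>\<^bsub>rep_ring H m\<^esub> f))\<rparr>"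

definition T1_index :: "nat \<Rightarrow> nat \<Rightarrow> (nat \<times> nat \<times> nat) set" where
  "T1_index m n = {(i, j, l). i \<in> {1..m} \<and> j \<in> {1..m} \<and> (i, j) \<noteq> (m, m) \<and> l \<in> {1..n}}"

end

theory Submission
  imports Defs
begin

text \<open>Write \<open>A(y)\<close> for the matrix of coordinate functions \<open>\<rho> \<mapsto> \<rho>(y)\<close> and \<open>S(y) = A(y) - 1\<close>.

  Spanning. Since \<open>A\<close> is multiplicative, \<open>S(y - z) = S(y) - A(y - z) S(z)\<close>; hence the \<open>y\<close> for which
  all entries of \<open>S(y)\<close> lie in the ideal \<open>J\<close> form a subgroup, and as it contains the basis it is all
  of \<open>H\<close> (\<open>s_coord_mem_J\<close>). So every function in the algebra is a rational constant modulo \<open>J\<close>, and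
  therefore the generators of \<open>J\<close> as an ideal span \<open>J\<close> modulo \<open>J\<^sup>2\<close> already over the rationals
  (\<open>span_mod_J2\<close>). Expanding \<open>1 = det (1 + S(x\<^sub>l))\<close> by the Leibniz formula, every permutation other
  than the identity moves two indices and contributes an element of \<open>J\<^sup>2\<close>, while the identity
  contributes \<open>1 + tr S(x\<^sub>l)\<close> modulo \<open>J\<^sup>2\<close>. So the trace of \<open>S(x\<^sub>l)\<close> lies in \<open>J\<^sup>2\<close> (\<open>trace_mem_J2\<close>),
  and the entry at \<open>(m, m)\<close> is redundant.

  Independence. Elements of \<open>J\<close> vanish at the trivial representation, so elements of \<open>J\<^sup>2\<close> have
  derivative zero along every curve of representations through it. If \<open>N\<^sup>2 = 0\<close>, then
  \<open>t \<mapsto> 1 + t N\<close> is a one-parameter subgroup of the special linear group, so sending \<open>x\<^sub>l\<close> to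
  \<open>1 + t N\<close> and the other basis elements to \<open>1\<close> gives such a curve, along which the entries of
  \<open>S(x\<^sub>l)\<close> have the entries of \<open>N\<close> as derivatives. Matrix units off the diagonal detect the
  off-diagonal coefficients of a relation, and the matrices
  \<open>(e\<^sub>i + e\<^sub>m)(e\<^sub>i - e\<^sub>m)\<^sup>T\<close> then detect the diagonal ones (\<open>J2_tangent\<close>, \<open>T1_independent\<close>).\<close>

section \<open>Pointwise algebras of functions and their ideals\<close>

lemma cring_fun_ring: "cring (fun_ring X)"
proof (rule cringI)
  show "abelian_group (fun_ring X)"
  proof (rule abelian_groupI)
    fix f assume f: "f \<in> carrier (fun_ring X)"
    show "\<exists>g\<in>carrier (fun_ring X). g \<oplus>\<^bsub>fun_ring X\<^esub> f = \<zero>\<^bsub>fun_ring X\<^esub>"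
      by (rule bexI[of _ "\<lambda>p\<in>X. - f p"]) (auto simp: fun_ring_def)
  qed (auto simp: fun_ring_def fun_eq_iff extensional_def)
  show "comm_monoid (fun_ring X)"
    by (rule comm_monoidI) (auto simp: fun_ring_def fun_eq_iff extensional_def)
qed (auto simp: fun_ring_def fun_eq_iff algebra_simps)

text \<open>Unconditional evaluation of a restricted function also rewrites its eta-expanded form, which
  turns it into a conditional expression. With the rules below it is evaluated only at points known
  to lie in the domain; the congruence rule supplies this knowledge inside nested restrictions.\<close>

declare restrict_cong [cong] restrict_apply [simp del] restrict_apply' [simp]

locale rational_function_algebra =
  fixes X :: "'x set" and V :: "('x \<Rightarrow> complex) set"
  assumes subalgebra: "rat_subalgebra X V"
begin

definition R :: "('x \<Rightarrow> complex) ring" where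
  "R = fun_ring X\<lparr>carrier := V\<rparr>"

lemma R_simps [simp]:
  "carrier R = V"
  "f \<oplus>\<^bsub>R\<^esub> g = (\<lambda>p\<in>X. f p + g p)"
  "f \<otimes>\<^bsub>R\<^esub> g = (\<lambda>p\<in>X. f p * g p)"
  "\<zero>\<^bsub>R\<^esub> = (\<lambda>p\<in>X. 0)"
  "\<one>\<^bsub>R\<^esub> = (\<lambda>p\<in>X. 1)"
  by (simp_all add: R_def fun_ring_def)

lemma cring_R: "cring R"
proof -
  interpret F: cring "fun_ring X" by (rule cring_fun_ring)
  have "subring V (fun_ring X)" using subalgebra by (simp add: rat_subalgebra_def)
  then show ?thesis unfolding R_def
    using F.subcringI' F.subcring_iff subringE(1) by blast
qed

sublocale R: cring R by (rule cring_R)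

lemma V_extensional: "f \<in> V \<Longrightarrow> f \<in> extensional X"
  using subalgebra subringE(1)[of V "fun_ring X"]
  by (auto simp: rat_subalgebra_def fun_ring_def)

lemma restrict_V: "f \<in> V \<Longrightarrow> restrict f X = f"
  by (simp add: V_extensional extensional_restrict)

lemma const_V: "(\<lambda>p\<in>X. of_rat q) \<in> V"
proof -
  have "rat_const X q \<otimes>\<^bsub>fun_ring X\<^esub> \<one>\<^bsub>R\<^esub> \<in> V"
    using subalgebra R.one_closed unfolding rat_subalgebra_def by simp
  then show ?thesis by (simp add: fun_ring_def rat_const_def)
qed

text \<open>The closure rules below speak of \<open>restrict f X\<close> rather than of \<open>f\<close>, so that they apply directly to
  functions given by a pointwise formula.\<close>

lemma ideal_mult:
  assumes "ideal I R" "restrict f X \<in> V" "restrict g X \<in> I"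
  shows "(\<lambda>p\<in>X. f p * g p) \<in> I"
  using ideal.I_l_closed[OF assms(1,3), of "restrict f X"] assms(2)
  by simp

lemma ideal_add:
  assumes "ideal I R" "restrict f X \<in> I" "restrict g X \<in> I"
  shows "(\<lambda>p\<in>X. f p + g p) \<in> I"
  using additive_subgroup.a_closed[OF ideal.axioms(1)[OF assms(1)] assms(2,3)]
  by simp

lemma ideal_scale:
  assumes "ideal I R" "restrict g X \<in> I"
  shows "(\<lambda>p\<in>X. of_rat q * g p) \<in> I"
  by (rule ideal_mult[OF assms(1) const_V assms(2)])

lemma ideal_uminus:
  assumes "ideal I R" "restrict g X \<in> I"
  shows "(\<lambda>p\<in>X. - g p) \<in> I"
  using ideal_scale[OF assms, of "-1"] by simp

lemma ideal_diff:
  assumes "ideal I R" "restrict f X \<in> I" "restrict g X \<in> I"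
  shows "(\<lambda>p\<in>X. f p - g p) \<in> I"
  using ideal_add[OF assms(1,2) ideal_uminus[OF assms(1,3)]]
  by simp

lemma ideal_zero: "ideal I R \<Longrightarrow> (\<lambda>p\<in>X. 0) \<in> I"
  using additive_subgroup.zero_closed[OF ideal.axioms(1)] by fastforce

lemma ideal_sum:
  assumes "ideal I R" "\<And>a. a \<in> A \<Longrightarrow> restrict (f a) X \<in> I"
  shows "(\<lambda>p\<in>X. \<Sum>a\<in>A. f a p) \<in> I"
  using assms(2)
proof (induction A rule: infinite_finite_induct)
  case (insert a A)
  then show ?case using ideal_add[OF assms(1), of "f a" "\<lambda>p. \<Sum>a\<in>A. f a p"] by simp
qed (simp_all add: ideal_zero[OF assms(1)])

lemma ideal_subset_V: "ideal I R \<Longrightarrow> I \<subseteq> V"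
  using ideal.Icarr by fastforce

text \<open>The algebra is an ideal of itself, so the closure rules for ideals also give those of
  the algebra.\<close>

lemma ideal_V: "ideal V R"
  using R.oneideal by simp

lemma prod_V:
  assumes "\<And>a. a \<in> A \<Longrightarrow> restrict (f a) X \<in> V"
  shows "(\<lambda>p\<in>X. \<Prod>a\<in>A. f a p) \<in> V"
  using assms
proof (induction A rule: infinite_finite_induct)
  case (insert a A)
  then show ?case using ideal_mult[OF ideal_V, of "f a" "\<lambda>p. \<Prod>a\<in>A. f a p"] by simp
qed (use const_V[of 1] in simp_all)

end

section \<open>The cotangent space of an ideal\<close>

locale function_algebra_ideal = rational_function_algebra +
  fixes J :: "('a \<Rightarrow> complex) set"
  assumes ideal_J: "ideal J R"
begin

definition J2 :: "('a \<Rightarrow> complex) set" where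
  "J2 = J \<cdot>\<^bsub>R\<^esub> J"

definition cls :: "('a \<Rightarrow> complex) \<Rightarrow> ('a \<Rightarrow> complex) set" where
  "cls f = J2 +>\<^bsub>R\<^esub> f"

definition cotangent :: "(rat, ('a \<Rightarrow> complex) set) module" where
  "cotangent = \<lparr>carrier = cls ` J, mult = undefined, one = undefined, zero = J2,
     add = set_add R, smult = (\<lambda>q A. \<Union>f\<in>A. cls (rat_const X q \<otimes>\<^bsub>R\<^esub> f))\<rparr>"

lemma ideal_J2: "ideal J2 R"
  unfolding J2_def by (rule R.ideal_prod_is_ideal[OF ideal_J ideal_J])

lemma J_V: "f \<in> J \<Longrightarrow> f \<in> V"
  using ideal_subset_V[OF ideal_J] by blast

lemma J2_J: "f \<in> J2 \<Longrightarrow> f \<in> J"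
  using R.ideal_prod_inter[OF ideal_J ideal_J] by (auto simp: J2_def)

lemma J2_prod:
  assumes "restrict f X \<in> J" "restrict g X \<in> J"
  shows "(\<lambda>p\<in>X. f p * g p) \<in> J2"
  using ideal_prod.prod[of "restrict f X" J "restrict g X" J R] assms
  by (simp add: J2_def)

lemma J2_subsetI:
  assumes "\<And>f g. f \<in> J \<Longrightarrow> g \<in> J \<Longrightarrow> (\<lambda>p\<in>X. f p * g p) \<in> S"
    and "\<And>f g. f \<in> J2 \<Longrightarrow> g \<in> J2 \<Longrightarrow> f \<in> S \<Longrightarrow> g \<in> S \<Longrightarrow> (\<lambda>p\<in>X. f p + g p) \<in> S"
  shows "J2 \<subseteq> S"
proof
  fix h assume "h \<in> J2"
  then show "h \<in> S" unfolding J2_def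
    by (induction rule: ideal_prod.induct) (simp_all add: assms[unfolded J2_def])
qed

text \<open>Congruence modulo the square of the ideal in terms of pointwise differences, which the closure
  rules for ideals can prove.\<close>

lemma mem_cls_iff:
  assumes "f \<in> V"
  shows "g \<in> cls f \<longleftrightarrow> g \<in> V \<and> (\<lambda>p\<in>X. g p - f p) \<in> J2"
proof
  assume "g \<in> cls f"
  then obtain h where h: "h \<in> J2" "g = (\<lambda>p\<in>X. h p + f p)"
    by (auto simp: cls_def a_r_coset_def')
  then have "h \<in> V" "restrict h X = h" using J2_J J_V restrict_V by blast+
  then show "g \<in> V \<and> (\<lambda>p\<in>X. g p - f p) \<in> J2"
    using h assms ideal_add[OF ideal_V, of h f] by (simp add: restrict_V)
next
  assume g: "g \<in> V \<and> (\<lambda>p\<in>X. g p - f p) \<in> J2"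
  have "(\<lambda>p\<in>X. g p) = (\<lambda>p\<in>X. (\<lambda>p\<in>X. g p - f p) p + f p)" by simp
  then have "g = (\<lambda>p\<in>X. (\<lambda>p\<in>X. g p - f p) p + f p)" using g restrict_V by simp
  then show "g \<in> cls f" using g unfolding cls_def a_r_coset_def' R_simps by blast
qed

lemma cls_self: "f \<in> V \<Longrightarrow> f \<in> cls f"
  by (simp add: mem_cls_iff ideal_zero[OF ideal_J2])

lemma cls_eq_iff:
  assumes "f \<in> V" "g \<in> V"
  shows "cls f = cls g \<longleftrightarrow> (\<lambda>p\<in>X. f p - g p) \<in> J2"
proof
  assume "cls f = cls g"
  then show "(\<lambda>p\<in>X. f p - g p) \<in> J2" using cls_self assms mem_cls_iff by blast
next
  assume fg: "(\<lambda>p\<in>X. f p - g p) \<in> J2"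
  have "(\<lambda>p\<in>X. h p - g p) \<in> J2 \<longleftrightarrow> (\<lambda>p\<in>X. h p - f p) \<in> J2" for h
    using ideal_add[OF ideal_J2 _ fg, of "\<lambda>p. h p - f p"]
      ideal_diff[OF ideal_J2 _ fg, of "\<lambda>p. h p - g p"] by auto
  then show "cls f = cls g" using assms by (auto simp: mem_cls_iff)
qed

lemma cls_zero: "cls (\<lambda>p\<in>X. 0) = J2"
proof -
  have "g \<in> cls (\<lambda>p\<in>X. 0) \<longleftrightarrow> g \<in> V \<and> restrict g X \<in> J2" for g
    using mem_cls_iff[of "\<lambda>p\<in>X. 0" g] const_V[of 0] by simp
  then show ?thesis using ideal_subset_V[OF ideal_J2] restrict_V by auto
qed

lemma add_cls:
  assumes "f \<in> J" "g \<in> J"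
  shows "cls f \<oplus>\<^bsub>cotangent\<^esub> cls g = cls (\<lambda>p\<in>X. f p + g p)"
proof -
  interpret J2: ideal J2 R by (rule ideal_J2)
  show ?thesis using J2.a_rcos_sum[of f g] assms J_V by (simp add: cotangent_def cls_def)
qed

text \<open>The scalar multiple of a class is a union over all representatives; it is a single class because
  scaling preserves the square of the ideal.\<close>

lemma smult_cls:
  assumes "f \<in> J"
  shows "q \<odot>\<^bsub>cotangent\<^esub> cls f = cls (\<lambda>p\<in>X. of_rat q * f p)"
proof -
  have f: "f \<in> V" using assms J_V by blast
  have "cls (\<lambda>p\<in>X. of_rat q * g p) = cls (\<lambda>p\<in>X. of_rat q * f p)" if "g \<in> cls f" for g
  proof -
    have g: "g \<in> V" "(\<lambda>p\<in>X. g p - f p) \<in> J2" using that f by (auto simp: mem_cls_iff)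
    then show ?thesis
      using ideal_scale[OF ideal_J2 g(2), of q] f
      by (subst cls_eq_iff)
        (auto intro!: ideal_scale[OF ideal_V] simp: restrict_V algebra_simps)
  qed
  moreover have "rat_const X q \<otimes>\<^bsub>R\<^esub> g = (\<lambda>p\<in>X. of_rat q * g p)" for g
    by (simp add: rat_const_def)
  ultimately have "q \<odot>\<^bsub>cotangent\<^esub> cls f = (\<Union>g\<in>cls f. cls (\<lambda>p\<in>X. of_rat q * f p))"
    unfolding cotangent_def by (simp only: module.simps) (rule SUP_cong, simp_all only:)
  then show ?thesis using cls_self[OF f] by auto
qed

lemma cotangent_simps:
  "carrier cotangent = cls ` J" "\<zero>\<^bsub>cotangent\<^esub> = cls (\<lambda>p\<in>X. 0)"
  by (simp_all add: cotangent_def cls_zero)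

lemma restrict_J: "f \<in> J \<Longrightarrow> restrict f X = f"
  by (simp add: J_V restrict_V)

lemma J_closed:
  assumes "f \<in> J"
  shows "g \<in> J \<Longrightarrow> (\<lambda>p\<in>X. f p + g p) \<in> J" "(\<lambda>p\<in>X. of_rat q * f p) \<in> J"
  using ideal_add[OF ideal_J, of f g] ideal_scale[OF ideal_J, of f q] assms
  by (simp_all add: restrict_J)

lemma vectorspace_cotangent: "vectorspace (class_ring :: rat ring) cotangent"
proof -
  have "module (class_ring :: rat ring) cotangent"
  proof (rule module_criteria)
    show "cring (class_ring :: rat ring)" by (rule class_cring.cring_axioms)
    show "\<forall>v\<in>carrier cotangent. \<exists>w\<in>carrier cotangent. v \<oplus>\<^bsub>cotangent\<^esub> w = \<zero>\<^bsub>cotangent\<^esub>"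
    proof
      fix v assume "v \<in> carrier cotangent"
      then obtain f where f: "v = cls f" "f \<in> J" by (auto simp: cotangent_simps)
      then have m: "(\<lambda>p\<in>X. - f p) \<in> J" using ideal_uminus[OF ideal_J, of f]
        by (simp add: restrict_J)
      then have "v \<oplus>\<^bsub>cotangent\<^esub> cls (\<lambda>p\<in>X. - f p) = \<zero>\<^bsub>cotangent\<^esub>"
        using f by (simp add: add_cls cotangent_simps)
      with m show "\<exists>w\<in>carrier cotangent. v \<oplus>\<^bsub>cotangent\<^esub> w = \<zero>\<^bsub>cotangent\<^esub>"
        by (auto simp: cotangent_simps)
    qed
    show "\<forall>v w. v \<in> carrier cotangent \<and> w \<in> carrier cotangent \<longrightarrow>
      v \<oplus>\<^bsub>cotangent\<^esub> w \<in> carrier cotangent"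
      by (auto simp: cotangent_simps add_cls J_closed)
    show "\<forall>c v. c \<in> carrier class_ring \<and> v \<in> carrier cotangent \<longrightarrow>
      c \<odot>\<^bsub>cotangent\<^esub> v \<in> carrier cotangent"
      by (auto simp: cotangent_simps smult_cls J_closed)
    show "\<forall>a b v. a \<in> carrier class_ring \<and> b \<in> carrier class_ring \<and> v \<in> carrier cotangent \<longrightarrow>
      (a \<otimes>\<^bsub>class_ring\<^esub> b) \<odot>\<^bsub>cotangent\<^esub> v = a \<odot>\<^bsub>cotangent\<^esub> (b \<odot>\<^bsub>cotangent\<^esub> v)"
      by (auto simp: cotangent_simps add_cls smult_cls J_closed restrict_J of_rat_add of_rat_mult
        distrib_left distrib_right mult.assoc)
    show "\<forall>v\<in>carrier cotangent. \<one>\<^bsub>class_ring\<^esub> \<odot>\<^bsub>cotangent\<^esub> v = v"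
      by (auto simp: cotangent_simps add_cls smult_cls J_closed restrict_J of_rat_add of_rat_mult
        distrib_left distrib_right mult.assoc)
    show "\<forall>a b v. a \<in> carrier class_ring \<and> b \<in> carrier class_ring \<and> v \<in> carrier cotangent \<longrightarrow>
      (a \<oplus>\<^bsub>class_ring\<^esub> b) \<odot>\<^bsub>cotangent\<^esub> v =
        a \<odot>\<^bsub>cotangent\<^esub> v \<oplus>\<^bsub>cotangent\<^esub> b \<odot>\<^bsub>cotangent\<^esub> v"
      by (auto simp: cotangent_simps add_cls smult_cls J_closed restrict_J of_rat_add of_rat_mult
        distrib_left distrib_right mult.assoc)
    show "\<forall>a v w. a \<in> carrier class_ring \<and> v \<in> carrier cotangent \<and> w \<in> carrier cotangent \<longrightarrow>
      a \<odot>\<^bsub>cotangent\<^esub> (v \<oplus>\<^bsub>cotangent\<^esub> w) =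
        a \<odot>\<^bsub>cotangent\<^esub> v \<oplus>\<^bsub>cotangent\<^esub> a \<odot>\<^bsub>cotangent\<^esub> w"
      by (auto simp: cotangent_simps add_cls smult_cls J_closed restrict_J of_rat_add of_rat_mult
        distrib_left distrib_right mult.assoc)
  qed (auto simp: cotangent_simps add_cls J_closed ideal_zero[OF ideal_J] restrict_J add_ac)
  then show ?thesis
    by (intro vectorspace.intro class_field.field_axioms)
qed

text \<open>Coefficients are indexed by the vectors in \<^const>\<open>module.lincomb\<close> and by the index set in
  the sum below; injectivity of the parametrisation reconciles the two.\<close>

lemma lincomb_cls:
  assumes "finite I" "inj_on (\<lambda>i. cls (s i)) I" "\<And>i. i \<in> I \<Longrightarrow> s i \<in> J"
  shows "module.lincomb cotangent a ((\<lambda>i. cls (s i)) ` I) =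
    cls (\<lambda>p\<in>X. \<Sum>i\<in>I. of_rat (a (cls (s i))) * s i p)"
  using assms
proof (induction I)
  interpret vectorspace "class_ring :: rat ring" cotangent by (rule vectorspace_cotangent)
  case empty
  then show ?case by (simp add: lincomb_def cotangent_simps)
next
  interpret vectorspace "class_ring :: rat ring" cotangent by (rule vectorspace_cotangent)
  case (insert i I)
  have sum: "(\<lambda>p\<in>X. \<Sum>i\<in>I. of_rat (a (cls (s i))) * s i p) \<in> J"
    using insert.prems by (intro ideal_sum ideal_J) (auto intro: J_closed)
  have "lincomb a ((\<lambda>i. cls (s i)) ` I \<union> {cls (s i)}) =
    a (cls (s i)) \<odot>\<^bsub>cotangent\<^esub> cls (s i) \<oplus>\<^bsub>cotangent\<^esub> lincomb a ((\<lambda>i. cls (s i)) ` I)"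
    by (rule lincomb_insert) (use insert in \<open>auto simp: cotangent_simps inj_on_def\<close>)
  then show ?case using insert sum
    by (simp add: smult_cls add_cls J_closed)
qed

text \<open>The basis property reduced to two statements about functions modulo the square of the ideal.
  Injectivity of the family is a case of independence, applied to the difference of two unit
  vectors.\<close>

lemma basis_cotangentI:
  assumes finite_I: "finite I" and s: "\<And>i. i \<in> I \<Longrightarrow> s i \<in> J"
    and span: "\<And>f. f \<in> J \<Longrightarrow> \<exists>c. (\<lambda>p\<in>X. f p - (\<Sum>i\<in>I. of_rat (c i) * s i p)) \<in> J2"
    and indep: "\<And>c i. (\<lambda>p\<in>X. \<Sum>i\<in>I. of_rat (c i) * s i p) \<in> J2 \<Longrightarrow> i \<in> I \<Longrightarrow> c i = 0"
  shows "inj_on (\<lambda>i. cls (s i)) I"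
    and "vectorspace.basis (class_ring :: rat ring) cotangent ((\<lambda>i. cls (s i)) ` I)"
proof -
  interpret vectorspace "class_ring :: rat ring" cotangent by (rule vectorspace_cotangent)
  let ?F = "\<lambda>i. cls (s i)"
  have sumJ: "(\<lambda>p\<in>X. \<Sum>i\<in>I. of_rat (c i) * s i p) \<in> J" for c
    using s by (intro ideal_sum ideal_J) (auto intro: J_closed)
  show inj: "inj_on ?F I"
  proof (rule inj_onI, rule ccontr)
    fix i j assume ij: "i \<in> I" "j \<in> I" "?F i = ?F j" "i \<noteq> j"
    let ?c = "\<lambda>k. (if k = i then 1 else 0) - (if k = j then 1 else 0) :: rat"
    have "(\<Sum>k\<in>I. of_rat (?c k) * s k p) =
        (\<Sum>k\<in>I. if k = i then s k p else 0) - (\<Sum>k\<in>I. if k = j then s k p else 0)" for p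
      unfolding sum_subtractf[symmetric] by (rule sum.cong) auto
    moreover have "(\<Sum>k\<in>I. if k = i then s k p else 0) = s i p"
      "(\<Sum>k\<in>I. if k = j then s k p else 0) = s j p" for p
      using ij finite_I by (simp_all add: sum.delta)
    ultimately have "(\<Sum>k\<in>I. of_rat (?c k) * s k p) = s i p - s j p" for p
      by (simp only:)
    moreover have "(\<lambda>p\<in>X. s i p - s j p) \<in> J2" using ij s J_V cls_eq_iff by blast
    ultimately have "?c i = 0" using indep[of ?c i] ij by presburger
    then show False using ij by simp
  qed
  have sub: "?F ` I \<subseteq> carrier cotangent" using s by (auto simp: cotangent_simps)
  have "lin_indpt (?F ` I)"
  proof (rule finite_lin_indpt2)
    fix a assume "lincomb a (?F ` I) = \<zero>\<^bsub>cotangent\<^esub>"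
    then have "cls (\<lambda>p\<in>X. \<Sum>i\<in>I. of_rat (a (?F i)) * s i p) = cls (\<lambda>p\<in>X. 0)"
      using lincomb_cls[OF finite_I inj s] by (simp add: cotangent_simps)
    then have "(\<lambda>p\<in>X. \<Sum>i\<in>I. of_rat (a (?F i)) * s i p) \<in> J2"
      using sumJ ideal_zero[OF ideal_J] J_V by (subst (asm) cls_eq_iff) (auto)
    then have "a (?F i) = 0" if "i \<in> I" for i
      using indep[of "\<lambda>i. a (?F i)" i] that by blast
    then show "\<forall>v\<in>?F ` I. a v = \<zero>\<^bsub>class_ring\<^esub>" by simp
  qed (use finite_I sub in auto)
  moreover have "span (?F ` I) = carrier cotangent"
  proof
    show "span (?F ` I) \<subseteq> carrier cotangent"
      using sub finite_I by (auto simp: finite_span)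
    show "carrier cotangent \<subseteq> span (?F ` I)"
    proof
      fix v assume "v \<in> carrier cotangent"
      then obtain f where f: "v = cls f" "f \<in> J" by (auto simp: cotangent_simps)
      then obtain c where c: "(\<lambda>p\<in>X. f p - (\<Sum>i\<in>I. of_rat (c i) * s i p)) \<in> J2"
        using span by blast
      let ?a = "\<lambda>w. c (the_inv_into I ?F w)"
      have "lincomb ?a (?F ` I) = cls (\<lambda>p\<in>X. \<Sum>i\<in>I. of_rat (c i) * s i p)"
        using lincomb_cls[OF finite_I inj s, of ?a] by (simp add: the_inv_into_f_f[OF inj])
      also have "\<dots> = v" unfolding f(1)
        using c f sumJ J_V by (subst eq_commute, subst cls_eq_iff) (auto)
      finally show "v \<in> span (?F ` I)" using finite_I sub by (auto simp: finite_span)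
    qed
  qed
  ultimately show "basis (?F ` I)" using sub by (simp add: basis_def)
qed

end

section \<open>Generated subalgebras\<close>

lemma rat_subalgebraI:
  assumes "W \<subseteq> extensional X"
    and const: "\<And>q. (\<lambda>p\<in>X. of_rat q) \<in> W"
    and add: "\<And>f g. f \<in> W \<Longrightarrow> g \<in> W \<Longrightarrow> (\<lambda>p\<in>X. f p + g p) \<in> W"
    and mult: "\<And>f g. f \<in> W \<Longrightarrow> g \<in> W \<Longrightarrow> (\<lambda>p\<in>X. f p * g p) \<in> W"
  shows "rat_subalgebra X W"
proof -
  interpret F: cring "fun_ring X" by (rule cring_fun_ring)
  have sub: "W \<subseteq> carrier (fun_ring X)" using assms(1) by (simp add: fun_ring_def)
  have "subring W (fun_ring X)"
  proof (rule F.subringI[OF sub])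
    show "\<one>\<^bsub>fun_ring X\<^esub> \<in> W" using const[of 1] by (simp add: fun_ring_def)
    fix f g assume fg: "f \<in> W" "g \<in> W"
    show "f \<otimes>\<^bsub>fun_ring X\<^esub> g \<in> W" "f \<oplus>\<^bsub>fun_ring X\<^esub> g \<in> W"
      using add[OF fg] mult[OF fg] by (simp_all add: fun_ring_def)
  next
    fix f assume f: "f \<in> W"
    have m: "(\<lambda>p\<in>X. - f p) \<in> W" using mult[OF const[of "-1"] f] by simp
    have "\<ominus>\<^bsub>fun_ring X\<^esub> f = (\<lambda>p\<in>X. - f p)"
      by (rule F.minus_equality) (use f m sub in \<open>auto simp: fun_ring_def\<close>)
    with m show "\<ominus>\<^bsub>fun_ring X\<^esub> f \<in> W" by simp
  qed
  moreover have "rat_const X q \<otimes>\<^bsub>fun_ring X\<^esub> f \<in> W" if "f \<in> W" for q f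
    using mult[OF const[of q] that] by (simp add: fun_ring_def rat_const_def)
  ultimately show ?thesis by (simp add: rat_subalgebra_def)
qed

lemma rat_algebra_generated_least:
  "rat_subalgebra X W \<Longrightarrow> S \<subseteq> W \<Longrightarrow> rat_algebra_generated X S \<subseteq> W"
  unfolding rat_algebra_generated_def by (rule Inter_lower) simp

lemma rat_algebra_generated_incl: "S \<subseteq> rat_algebra_generated X S"
  unfolding rat_algebra_generated_def by auto

lemma rat_subalgebra_generated:
  assumes "S \<subseteq> extensional X"
  shows "rat_subalgebra X (rat_algebra_generated X S)"
proof (rule rat_subalgebraI)
  have "rat_subalgebra X (extensional X)" by (rule rat_subalgebraI) auto
  with assms show "rat_algebra_generated X S \<subseteq> extensional X"
    by (intro rat_algebra_generated_least)
next
  fix q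
  show "(\<lambda>p\<in>X. of_rat q) \<in> rat_algebra_generated X S"
    using rational_function_algebra.const_V
    by (auto simp: rat_algebra_generated_def rational_function_algebra_def)
next
  fix f g assume fg: "f \<in> rat_algebra_generated X S" "g \<in> rat_algebra_generated X S"
  have "(\<lambda>p\<in>X. f p + g p) \<in> W \<and> (\<lambda>p\<in>X. f p * g p) \<in> W" if "rat_subalgebra X W" "S \<subseteq> W" for W
  proof -
    interpret rational_function_algebra X W by unfold_locales (rule that)
    have "f \<in> W" "g \<in> W" using fg that by (auto simp: rat_algebra_generated_def)
    then show ?thesis
      using ideal_add[OF ideal_V, of f g] ideal_mult[OF ideal_V, of f g] by (simp add: restrict_V)
  qed
  then show "(\<lambda>p\<in>X. f p + g p) \<in> rat_algebra_generated X S"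
    "(\<lambda>p\<in>X. f p * g p) \<in> rat_algebra_generated X S"
    by (auto simp: rat_algebra_generated_def)
qed

context rational_function_algebra
begin

lemma pointwise_idealI:
  assumes "I \<subseteq> V" "(\<lambda>p\<in>X. 0) \<in> I"
    and add: "\<And>f g. f \<in> I \<Longrightarrow> g \<in> I \<Longrightarrow> (\<lambda>p\<in>X. f p + g p) \<in> I"
    and mult: "\<And>f g. f \<in> V \<Longrightarrow> g \<in> I \<Longrightarrow> (\<lambda>p\<in>X. f p * g p) \<in> I"
  shows "ideal I R"
proof (rule idealI[OF R.ring_axioms])
  show "subgroup I (add_monoid R)"
  proof (rule R.add.subgroupI)
    show "I \<subseteq> carrier (R)" "I \<noteq> {}" using assms by auto
    fix f g assume fg: "f \<in> I" "g \<in> I"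
    then show "f \<oplus>\<^bsub>R\<^esub> g \<in> I" using add by simp
    have m: "(\<lambda>p\<in>X. - f p) \<in> I" using mult[OF const_V[of "-1"] fg(1)] by simp
    have "\<ominus>\<^bsub>R\<^esub> f = (\<lambda>p\<in>X. - f p)"
      by (rule R.minus_equality) (use fg m assms(1) in auto)
    with m show "\<ominus>\<^bsub>R\<^esub> f \<in> I" by simp
  qed
next
  fix f g assume "f \<in> I" "g \<in> carrier R"
  then show "g \<otimes>\<^bsub>R\<^esub> f \<in> I" "f \<otimes>\<^bsub>R\<^esub> g \<in> I"
    using mult[of g f] by (simp_all add: mult.commute)
qed

end

section \<open>Generators of the cotangent space\<close>

context function_algebra_ideal
begin

text \<open>The functions congruent to a rational constant modulo an ideal form a subalgebra, so it suffices
  to look at generators of the algebra.\<close>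

lemma scalar_mod_J:
  assumes V: "V = rat_algebra_generated X S"
    and S: "\<And>f. f \<in> S \<Longrightarrow> \<exists>q. (\<lambda>p\<in>X. f p - of_rat q) \<in> J"
    and "f \<in> V"
  shows "\<exists>q. (\<lambda>p\<in>X. f p - of_rat q) \<in> J"
proof -
  let ?W = "{f \<in> V. \<exists>q. (\<lambda>p\<in>X. f p - of_rat q) \<in> J}"
  have "rat_subalgebra X ?W"
  proof (rule rat_subalgebraI)
    show "?W \<subseteq> extensional X" using V_extensional by auto
    fix q show "(\<lambda>p\<in>X. of_rat q) \<in> ?W"
      using const_V[of q] ideal_zero[OF ideal_J] by (auto intro!: exI[of _ q])
  next
    fix f g assume "f \<in> ?W" "g \<in> ?W"
    then obtain a b where f: "f \<in> V" "(\<lambda>p\<in>X. f p - of_rat a) \<in> J"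
      and g: "g \<in> V" "(\<lambda>p\<in>X. g p - of_rat b) \<in> J" by blast
    have "(\<lambda>p\<in>X. f p + g p) \<in> V" "(\<lambda>p\<in>X. f p * g p) \<in> V"
      using ideal_add[OF ideal_V, of f g] ideal_mult[OF ideal_V, of f g] f g
      by (simp_all add: restrict_V)
    moreover have "(\<lambda>p\<in>X. (f p + g p) - of_rat (a + b)) \<in> J"
      using ideal_add[OF ideal_J f(2) g(2)] by (simp add: of_rat_add algebra_simps)
    moreover have "(\<lambda>p\<in>X. f p * (g p - of_rat b)) \<in> J"
      using ideal_mult[OF ideal_J _ g(2), of f] f by (simp add: restrict_V)
    from ideal_add[OF ideal_J this ideal_scale[OF ideal_J f(2), of b]]
    have "(\<lambda>p\<in>X. f p * g p - of_rat (a * b)) \<in> J"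
      by (simp add: of_rat_mult algebra_simps)
    ultimately show "(\<lambda>p\<in>X. f p + g p) \<in> ?W" "(\<lambda>p\<in>X. f p * g p) \<in> ?W"
      by (auto intro: exI[of _ "a + b"] exI[of _ "a * b"])
  qed
  moreover have "S \<subseteq> ?W" using S rat_algebra_generated_incl[of S X] V by auto
  ultimately show ?thesis using rat_algebra_generated_least[of X ?W S] assms by auto
qed

text \<open>If the algebra consists of constants modulo \<open>J\<close>, then multiplying by \<open>f = q + j\<close> acts on \<open>J / J\<^sup>2\<close>
  as multiplication by the rational number \<open>q\<close>. Hence the functions that are rational combinations
  of the \<open>s i\<close> modulo \<open>J\<^sup>2\<close> form an ideal, and \<open>J\<close> is contained in it as soon as its generators
  are.\<close>

lemma span_mod_J2:
  assumes J: "J = Idl\<^bsub>R\<^esub> G" and G: "G \<subseteq> V"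
    and scalar: "\<And>f. f \<in> V \<Longrightarrow> \<exists>q. (\<lambda>p\<in>X. f p - of_rat q) \<in> J"
    and s: "\<And>i. i \<in> I \<Longrightarrow> s i \<in> J"
    and gen: "\<And>g. g \<in> G \<Longrightarrow> \<exists>c. (\<lambda>p\<in>X. g p - (\<Sum>i\<in>I. of_rat (c i) * s i p)) \<in> J2"
    and f: "f \<in> J"
  shows "\<exists>c. (\<lambda>p\<in>X. f p - (\<Sum>i\<in>I. of_rat (c i) * s i p)) \<in> J2"
proof -
  let ?W = "{f \<in> V. \<exists>c. (\<lambda>p\<in>X. f p - (\<Sum>i\<in>I. of_rat (c i) * s i p)) \<in> J2}"
  have "ideal ?W R"
  proof (rule pointwise_idealI)
    show "(\<lambda>p\<in>X. 0) \<in> ?W"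
      using const_V[of 0] ideal_zero[OF ideal_J2] by (auto intro!: exI[of _ "\<lambda>_. 0"])
  next
    fix f g assume "f \<in> ?W" "g \<in> ?W"
    then obtain c d where f: "f \<in> V" "(\<lambda>p\<in>X. f p - (\<Sum>i\<in>I. of_rat (c i) * s i p)) \<in> J2"
      and g: "g \<in> V" "(\<lambda>p\<in>X. g p - (\<Sum>i\<in>I. of_rat (d i) * s i p)) \<in> J2" by blast
    have "(\<lambda>p\<in>X. (f p + g p) - (\<Sum>i\<in>I. of_rat (c i + d i) * s i p)) \<in> J2"
      using ideal_add[OF ideal_J2 f(2) g(2)]
      by (simp add: of_rat_add distrib_right sum.distrib algebra_simps)
    moreover have "(\<lambda>p\<in>X. f p + g p) \<in> V"
      using ideal_add[OF ideal_V, of f g] f g by (simp add: restrict_V)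
    ultimately show "(\<lambda>p\<in>X. f p + g p) \<in> ?W" by (auto intro: exI[of _ "\<lambda>i. c i + d i"])
  next
    fix f g assume fV: "f \<in> V" and "g \<in> ?W"
    then obtain d where g: "g \<in> V" "(\<lambda>p\<in>X. g p - (\<Sum>i\<in>I. of_rat (d i) * s i p)) \<in> J2" by blast
    obtain q where q: "(\<lambda>p\<in>X. f p - of_rat q) \<in> J" using scalar fV by blast
    have sum: "(\<lambda>p\<in>X. \<Sum>i\<in>I. of_rat (d i) * s i p) \<in> J"
      using s by (intro ideal_sum ideal_J) (auto intro: J_closed)
    have "(\<lambda>p\<in>X. f p * (g p - (\<Sum>i\<in>I. of_rat (d i) * s i p))) \<in> J2"
      using ideal_mult[OF ideal_J2 _ g(2), of f] fV by (simp add: restrict_V)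
    from ideal_add[OF ideal_J2 this J2_prod[OF q sum]]
    have "(\<lambda>p\<in>X. f p * g p - of_rat q * (\<Sum>i\<in>I. of_rat (d i) * s i p)) \<in> J2"
      by (simp add: algebra_simps)
    then have "(\<lambda>p\<in>X. f p * g p - (\<Sum>i\<in>I. of_rat (q * d i) * s i p)) \<in> J2"
      by (simp add: of_rat_mult sum_distrib_left mult.assoc)
    moreover have "(\<lambda>p\<in>X. f p * g p) \<in> V"
      using ideal_mult[OF ideal_V, of f g] fV g by (simp add: restrict_V)
    ultimately show "(\<lambda>p\<in>X. f p * g p) \<in> ?W" by (auto intro: exI[of _ "\<lambda>i. q * d i"])
  qed auto
  moreover have "G \<subseteq> ?W" using G gen by auto
  ultimately have "J \<subseteq> ?W" unfolding J by (rule R.genideal_minimal)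
  with f show ?thesis by auto
qed

text \<open>The product of factors \<open>1 + s\<^sub>i\<close> is \<open>1 + \<Sum> s\<^sub>i\<close> up to terms of degree at least two in the \<open>s\<^sub>i\<close>.\<close>

lemma J2_prod_linearize:
  assumes "finite A" "\<And>i. i \<in> A \<Longrightarrow> (\<lambda>p\<in>X. f i p - 1) \<in> J"
  shows "(\<lambda>p\<in>X. (\<Prod>i\<in>A. f i p) - 1 - (\<Sum>i\<in>A. f i p - 1)) \<in> J2"
  using assms
proof (induction A)
  case empty
  then show ?case by (simp add: ideal_zero[OF ideal_J2])
next
  case (insert a A)
  have fa: "(\<lambda>p\<in>X. f a p - 1) \<in> J" and fA: "\<And>i. i \<in> A \<Longrightarrow> (\<lambda>p\<in>X. f i p - 1) \<in> J"
    using insert.prems by auto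
  have faV: "restrict (f a) X \<in> V"
    using ideal_add[OF ideal_V, of "\<lambda>p. f a p - 1" "\<lambda>p. 1"] J_V[OF fa] const_V[of 1] by simp
  have "(\<lambda>p\<in>X. f a p * ((\<Prod>i\<in>A. f i p) - 1 - (\<Sum>i\<in>A. f i p - 1))) \<in> J2"
    using insert.IH[OF fA] by (intro ideal_mult ideal_J2 faV)
  moreover have "(\<lambda>p\<in>X. (f a p - 1) * (\<Sum>i\<in>A. f i p - 1)) \<in> J2"
    by (intro J2_prod fa ideal_sum ideal_J fA)
  ultimately have "(\<lambda>p\<in>X. f a p * ((\<Prod>i\<in>A. f i p) - 1 - (\<Sum>i\<in>A. f i p - 1)) +
      (f a p - 1) * (\<Sum>i\<in>A. f i p - 1)) \<in> J2"
    by (rule ideal_add[OF ideal_J2])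
  moreover have "f a p * ((\<Prod>i\<in>A. f i p) - 1 - (\<Sum>i\<in>A. f i p - 1)) +
      (f a p - 1) * (\<Sum>i\<in>A. f i p - 1) =
      (\<Prod>i\<in>insert a A. f i p) - 1 - (\<Sum>i\<in>insert a A. f i p - 1)" for p
    unfolding prod.insert[OF insert.hyps] sum.insert[OF insert.hyps] by (simp add: algebra_simps)
  ultimately show ?case by (simp only:)
qed

text \<open>The linear part of the determinant at the identity matrix is the trace, so for a matrix of
  determinant one that is congruent to the identity modulo \<open>J\<close> the trace of the difference is of
  second order.\<close>

lemma trace_mem_J2:
  fixes A :: "'a \<Rightarrow> complex mat"
  assumes A: "\<And>p. p \<in> X \<Longrightarrow> A p \<in> carrier_mat m m" "\<And>p. p \<in> X \<Longrightarrow> det (A p) = 1"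
    and J: "\<And>i j. i < m \<Longrightarrow> j < m \<Longrightarrow> (\<lambda>p\<in>X. A p $$ (i, j) - (if i = j then 1 else 0)) \<in> J"
  shows "(\<lambda>p\<in>X. \<Sum>i<m. A p $$ (i, i) - 1) \<in> J2"
proof -
  have entry_V: "(\<lambda>p\<in>X. A p $$ (i, j)) \<in> V" if "i < m" "j < m" for i j
    using ideal_add[OF ideal_V J_V[OF J[OF that]] const_V[of "if i = j then 1 else 0"]]
    by (simp split: if_splits)
  have off: "(\<lambda>p\<in>X. signof \<sigma> * (\<Prod>i=0..<m. A p $$ (i, \<sigma> i))) \<in> J2"
    if \<sigma>: "\<sigma> permutes {0..<m}" "\<sigma> \<noteq> id" for \<sigma>
  proof -
    \<comment> \<open>a permutation moving \<open>i\<close> also moves \<open>\<sigma> i\<close>, which gives two factors in \<open>J\<close>\<close>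
    obtain i where i: "\<sigma> i \<noteq> i" using \<sigma>(2) by (metis eq_id_iff)
    define j where "j = \<sigma> i"
    have im: "i < m" using i \<sigma>(1) permutes_not_in by fastforce
    have jm: "j < m" using im permutes_in_image[OF \<sigma>(1)] by (simp add: j_def)
    have j: "\<sigma> j \<noteq> j" using i permutes_inj[OF \<sigma>(1)] by (metis injD j_def)
    have sm: "k < m \<Longrightarrow> \<sigma> k < m" for k using permutes_in_image[OF \<sigma>(1)] by simp
    have "(\<lambda>p\<in>X. A p $$ (i, \<sigma> i) * A p $$ (j, \<sigma> j)) \<in> J2"
      using J[OF im sm[OF im]] J[OF jm sm[OF jm]] i j by (intro J2_prod) auto
    moreover have "(\<lambda>p\<in>X. of_rat (signof \<sigma>) * (\<Prod>k\<in>{0..<m} - {i, j}. A p $$ (k, \<sigma> k))) \<in> V"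
      by (intro ideal_scale ideal_V prod_V entry_V) (auto simp: sm)
    ultimately have "(\<lambda>p\<in>X. of_rat (signof \<sigma>) * (\<Prod>k\<in>{0..<m} - {i, j}. A p $$ (k, \<sigma> k)) *
        (A p $$ (i, \<sigma> i) * A p $$ (j, \<sigma> j))) \<in> J2"
      by (rule ideal_mult[OF ideal_J2, rotated])
    moreover have "(\<Prod>k=0..<m. A p $$ (k, \<sigma> k)) = (\<Prod>k\<in>{0..<m} - {i, j}. A p $$ (k, \<sigma> k)) *
        (A p $$ (i, \<sigma> i) * A p $$ (j, \<sigma> j))" for p
      using im jm i prod.subset_diff[of "{i, j}" "{0..<m}" "\<lambda>k. A p $$ (k, \<sigma> k)"]
      by (auto simp: j_def)
    moreover have "of_rat (signof \<sigma>) = (signof \<sigma> :: complex)" by (simp add: sign_def)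
    ultimately show ?thesis by (simp add: mult.assoc)
  qed
  let ?P = "{\<sigma>. \<sigma> permutes {0..<m}}"
  have "(\<lambda>p\<in>X. \<Sum>\<sigma>\<in>?P - {id}. signof \<sigma> * (\<Prod>i=0..<m. A p $$ (i, \<sigma> i))) \<in> J2"
    by (intro ideal_sum ideal_J2) (auto intro: off)
  moreover have "(\<lambda>p\<in>X. (\<Prod>i=0..<m. A p $$ (i, i)) - 1 - (\<Sum>i=0..<m. A p $$ (i, i) - 1)) \<in> J2"
    using J by (intro J2_prod_linearize) fastforce+
  ultimately have "(\<lambda>p\<in>X. - ((\<Sum>\<sigma>\<in>?P - {id}. signof \<sigma> * (\<Prod>i=0..<m. A p $$ (i, \<sigma> i))) +
      ((\<Prod>i=0..<m. A p $$ (i, i)) - 1 - (\<Sum>i=0..<m. A p $$ (i, i) - 1)))) \<in> J2"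
    by (intro ideal_uminus ideal_add ideal_J2)
  moreover have "- ((\<Sum>\<sigma>\<in>?P - {id}. signof \<sigma> * (\<Prod>i=0..<m. A p $$ (i, \<sigma> i))) +
      ((\<Prod>i=0..<m. A p $$ (i, i)) - 1 - (\<Sum>i=0..<m. A p $$ (i, i) - 1))) =
      (\<Sum>i<m. A p $$ (i, i) - 1)" if "p \<in> X" for p
  proof -
    have "id \<in> ?P" by (simp add: permutes_id)
    then have "det (A p) = signof id * (\<Prod>i=0..<m. A p $$ (i, id i)) +
        (\<Sum>\<sigma>\<in>?P - {id}. signof \<sigma> * (\<Prod>i=0..<m. A p $$ (i, \<sigma> i)))"
      unfolding det_def'[OF A(1)[OF that]]
      by (intro sum.remove) (simp_all add: finite_permutations)
    then show ?thesis using A(2)[OF that] by (simp add: lessThan_atLeast0 algebra_simps)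
  qed
  ultimately show ?thesis by (simp cong: restrict_cong)
qed

end

section \<open>Derivatives along curves\<close>

context function_algebra_ideal
begin

text \<open>By the product rule, a product of two functions that vanish at a point has derivative zero
  there.\<close>

lemma J2_deriv_zero:
  fixes \<gamma> :: "complex \<Rightarrow> 'a"
  assumes \<gamma>: "\<And>t. \<gamma> t \<in> X"
    and diff: "\<And>f. f \<in> V \<Longrightarrow> \<exists>d. ((\<lambda>t. f (\<gamma> t)) has_field_derivative d) (at 0)"
    and vanish: "\<And>f. f \<in> J \<Longrightarrow> f (\<gamma> 0) = 0"
    and f: "f \<in> J2"
  shows "((\<lambda>t. f (\<gamma> t)) has_field_derivative 0) (at 0)"
proof -
  have "J2 \<subseteq> {f. ((\<lambda>t. f (\<gamma> t)) has_field_derivative 0) (at 0)}"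
  proof (rule J2_subsetI)
    fix f g assume fg: "f \<in> J" "g \<in> J"
    obtain a b where "((\<lambda>t. f (\<gamma> t)) has_field_derivative a) (at 0)"
      "((\<lambda>t. g (\<gamma> t)) has_field_derivative b) (at 0)" using diff fg J_V by meson
    from DERIV_mult[OF this]
    show "(\<lambda>p\<in>X. f p * g p) \<in> {f. ((\<lambda>t. f (\<gamma> t)) has_field_derivative 0) (at 0)}"
      using fg by (simp add: \<gamma> vanish)
  next
    fix f g assume "f \<in> {f. ((\<lambda>t. f (\<gamma> t)) has_field_derivative 0) (at 0)}"
      "g \<in> {f. ((\<lambda>t. f (\<gamma> t)) has_field_derivative 0) (at 0)}"
    then show "(\<lambda>p\<in>X. f p + g p) \<in> {f. ((\<lambda>t. f (\<gamma> t)) has_field_derivative 0) (at 0)}"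
      using DERIV_add[of "\<lambda>t. f (\<gamma> t)" 0 0 UNIV "\<lambda>t. g (\<gamma> t)" 0] by (simp add: \<gamma>)
  qed
  with f show ?thesis by auto
qed

lemma differentiable_generated:
  fixes \<gamma> :: "complex \<Rightarrow> 'a"
  assumes \<gamma>: "\<And>t. \<gamma> t \<in> X" and V: "V = rat_algebra_generated X S"
    and S: "\<And>f. f \<in> S \<Longrightarrow> \<exists>d. ((\<lambda>t. f (\<gamma> t)) has_field_derivative d) (at 0)"
    and f: "f \<in> V"
  shows "\<exists>d. ((\<lambda>t. f (\<gamma> t)) has_field_derivative d) (at 0)"
proof -
  let ?W = "{f \<in> V. \<exists>d. ((\<lambda>t. f (\<gamma> t)) has_field_derivative d) (at 0)}"
  have "rat_subalgebra X ?W"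
  proof (rule rat_subalgebraI)
    show "?W \<subseteq> extensional X" using V_extensional by auto
    show "(\<lambda>p\<in>X. of_rat q) \<in> ?W" for q
      using const_V[of q] by (auto simp: \<gamma> intro: DERIV_const)
  next
    fix f g assume "f \<in> ?W" "g \<in> ?W"
    then obtain a b where fg: "f \<in> V" "g \<in> V" and
      d: "((\<lambda>t. f (\<gamma> t)) has_field_derivative a) (at 0)"
      "((\<lambda>t. g (\<gamma> t)) has_field_derivative b) (at 0)" by blast
    have "(\<lambda>p\<in>X. f p + g p) \<in> V" "(\<lambda>p\<in>X. f p * g p) \<in> V"
      using ideal_add[OF ideal_V, of f g] ideal_mult[OF ideal_V, of f g] fg
      by (simp_all add: restrict_V)
    then show "(\<lambda>p\<in>X. f p + g p) \<in> ?W" "(\<lambda>p\<in>X. f p * g p) \<in> ?W"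
      using DERIV_add[OF d] DERIV_mult[OF d] by (auto simp: \<gamma>)
  qed
  moreover have "S \<subseteq> ?W" using S rat_algebra_generated_incl[of S X] V by auto
  ultimately show ?thesis using rat_algebra_generated_least[of X ?W S] f V by auto
qed

lemma vanish_generated:
  assumes "J = Idl\<^bsub>R\<^esub> G" "G \<subseteq> V" "p \<in> X" "\<And>g. g \<in> G \<Longrightarrow> g p = 0" "f \<in> J"
  shows "f p = 0"
proof -
  have "ideal {f \<in> V. f p = 0} R"
  proof (rule pointwise_idealI)
    fix f g assume "f \<in> {f \<in> V. f p = 0}" "g \<in> {f \<in> V. f p = 0}"
    then show "(\<lambda>p\<in>X. f p + g p) \<in> {f \<in> V. f p = 0}"
      using ideal_add[OF ideal_V, of f g] assms(3) by (simp add: restrict_V)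
  next
    fix f g assume "f \<in> V" "g \<in> {f \<in> V. f p = 0}"
    then show "(\<lambda>p\<in>X. f p * g p) \<in> {f \<in> V. f p = 0}"
      using ideal_mult[OF ideal_V, of f g] assms(3) by (simp add: restrict_V)
  qed (use const_V[of 0] assms(3) in auto)
  then have "Idl\<^bsub>R\<^esub> G \<subseteq> {f \<in> V. f p = 0}"
    by (rule R.genideal_minimal) (use assms in auto)
  with assms show ?thesis by auto
qed

end

section \<open>Unipotent matrices and representations\<close>

text \<open>A matrix of square zero is the tangent vector of a one-parameter group that is linear in the
  parameter, since the exponential series stops after the linear term.\<close>

lemma mult_one_plus_square_zero:
  fixes N :: "'a :: comm_ring_1 mat"
  assumes N: "N \<in> carrier_mat m m" "N * N = 0\<^sub>m m m"
  shows "(1\<^sub>m m + a \<cdot>\<^sub>m N) * (1\<^sub>m m + b \<cdot>\<^sub>m N) = 1\<^sub>m m + (a + b) \<cdot>\<^sub>m N"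
proof -
  have c: "c \<cdot>\<^sub>m N \<in> carrier_mat m m" for c using N by simp
  have z: "(a \<cdot>\<^sub>m N) * (b \<cdot>\<^sub>m N) = 0\<^sub>m m m"
    using N by (simp add: mult_smult_distrib[OF c N(1)] mult_smult_assoc_mat[OF N(1) N(1)])
  have "(1\<^sub>m m + a \<cdot>\<^sub>m N) * (1\<^sub>m m + b \<cdot>\<^sub>m N) =
      (1\<^sub>m m + a \<cdot>\<^sub>m N) * 1\<^sub>m m + (1\<^sub>m m + a \<cdot>\<^sub>m N) * (b \<cdot>\<^sub>m N)"
    using c by (intro mult_add_distrib_mat[of _ m m]) auto
  also have "(1\<^sub>m m + a \<cdot>\<^sub>m N) * (b \<cdot>\<^sub>m N) = b \<cdot>\<^sub>m N"
    using c z N by (subst add_mult_distrib_mat[of _ m m]) auto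
  finally show ?thesis using N
    by (intro eq_matI) (auto simp: algebra_simps)
qed

text \<open>As a function of \<open>t\<close> the determinant is a polynomial \<open>p\<close> with \<open>p(t) p(- t) = 1\<close>; so \<open>p\<close> is a
  unit of the polynomial ring, that is, constant, and its value at \<open>0\<close> is \<open>1\<close>.\<close>

lemma det_one_plus_square_zero:
  fixes N :: "'a :: field_char_0 mat"
  assumes N: "N \<in> carrier_mat m m" "N * N = 0\<^sub>m m m"
  shows "det (1\<^sub>m m + t \<cdot>\<^sub>m N) = 1"
proof -
  define A where "A = mat m m (\<lambda>(i, j). [: (if i = j then 1 else 0), N $$ (i, j) :])"
  define p where "p = det A"
  have eval: "poly p a = det (1\<^sub>m m + a \<cdot>\<^sub>m N)" for a
  proof -
    interpret comm_ring_hom "\<lambda>p. poly p a" by unfold_locales auto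
    have "map_mat (\<lambda>p. poly p a) A = 1\<^sub>m m + a \<cdot>\<^sub>m N"
      using N by (intro eq_matI) (auto simp: A_def)
    then show ?thesis using hom_det[of A] by (simp add: p_def)
  qed
  have one: "1\<^sub>m m + (0::'a) \<cdot>\<^sub>m N = 1\<^sub>m m" using N by (intro eq_matI) auto
  have "poly p a * poly p (- a) = 1" for a
  proof -
    have "poly p a * poly p (- a) = det ((1\<^sub>m m + a \<cdot>\<^sub>m N) * (1\<^sub>m m + (- a) \<cdot>\<^sub>m N))"
      unfolding eval using N by (subst det_mult[of _ m]) auto
    then show ?thesis using mult_one_plus_square_zero[OF N, of a "- a"] one by simp
  qed
  then have "poly (p * (p \<circ>\<^sub>p [:0, -1:])) = poly 1" by (simp add: fun_eq_iff poly_pcompose)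
  then have "p * (p \<circ>\<^sub>p [:0, -1:]) = 1" by (simp only: poly_eq_poly_eq_iff)
  then have "p dvd 1" by (rule dvdI[OF sym])
  then obtain c where "p = [:c:]" by (auto simp: is_unit_poly_iff)
  then have "poly p t = poly p 0" by simp
  then show ?thesis unfolding eval one by simp
qed

lemma idempotent_det_one:
  fixes A :: "'a :: comm_ring_1 mat"
  assumes A: "A \<in> carrier_mat m m" "A * A = A" "det A = 1"
  shows "A = 1\<^sub>m m"
proof -
  note adj = adj_mat[OF A(1)]
  have left_inverse: "adj_mat A * A = 1\<^sub>m m"
    unfolding adj(3) A(3) by (intro eq_matI) auto
  have "adj_mat A * (A * A) = (adj_mat A * A) * A"
    using A(1) adj(1) by (simp add: assoc_mult_mat[of _ m m _ m _ m])
  then show ?thesis by (simp only: A(2) left_inverse left_mult_one_mat[OF A(1)])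
qed

lemma rank_one_square_zero:
  fixes u v :: "nat \<Rightarrow> 'a :: comm_ring_1"
  assumes "(\<Sum>k<m. v k * u k) = 0"
  shows "mat m m (\<lambda>(a, b). u a * v b) * mat m m (\<lambda>(a, b). u a * v b) = 0\<^sub>m m m"
proof (rule eq_matI)
  fix i j assume ij: "i < dim_row (0\<^sub>m m m :: 'a mat)" "j < dim_col (0\<^sub>m m m :: 'a mat)"
  have "(\<Sum>k<m. u i * v k * (u k * v j)) = u i * v j * (\<Sum>k<m. v k * u k)"
    unfolding sum_distrib_left by (rule sum.cong) (simp_all add: mult_ac)
  then show "(mat m m (\<lambda>(a, b). u a * v b) * mat m m (\<lambda>(a, b). u a * v b)) $$ (i, j) =
      0\<^sub>m m m $$ (i, j)"
    using ij assms by (simp add: scalar_prod_def lessThan_atLeast0)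
qed auto

lemma rep_set_mult:
  assumes "\<rho> \<in> rep_set H m" "y \<in> carrier H" "z \<in> carrier H"
  shows "\<rho> (y \<otimes>\<^bsub>H\<^esub> z) = \<rho> y * \<rho> z"
  using assms by (auto simp: rep_set_def hom_def SL_def)

lemma rep_set_carrier:
  assumes "\<rho> \<in> rep_set H m" "y \<in> carrier H"
  shows "\<rho> y \<in> carrier_mat m m" "det (\<rho> y) = 1"
  using assms by (auto simp: rep_set_def hom_def SL_def)

lemma rep_set_one:
  assumes "\<rho> \<in> rep_set H m" "group H"
  shows "\<rho> \<one>\<^bsub>H\<^esub> = 1\<^sub>m m"
proof -
  interpret group H by fact
  show ?thesis
    using rep_set_mult[OF assms(1) one_closed one_closed] rep_set_carrier[OF assms(1) one_closed]
    by (intro idempotent_det_one) simp_all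
qed

text \<open>The coordinates are indexed from 1 and the matrix entries from 0; the rules below translate
  between the two.\<close>

lemma coord_Suc: "coord H m (Suc i) (Suc j) y = (\<lambda>\<rho>\<in>rep_set H m. \<rho> y $$ (i, j))"
  by (simp add: coord_def)

lemma s_coord_Suc: "s_coord H m (Suc i) (Suc j) y =
    (\<lambda>\<rho>\<in>rep_set H m. \<rho> y $$ (i, j) - (if i = j then 1 else 0))"
  by (simp add: s_coord_def coord_def)

lemma one_based_index:
  assumes "i \<in> {1..m}"
  obtains k where "i = Suc k" "k < m"
  using assms by (cases i) auto

section \<open>Representations of a free abelian group\<close>

locale free_abelian_representations =
  fixes H :: "('h, 'b) monoid_scheme" and m n :: nat and x :: "nat \<Rightarrow> 'h"
    and \<phi> :: "(nat \<Rightarrow>\<^sub>0 int) \<Rightarrow> 'h"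
  assumes comm_H: "comm_group H"
    and iso: "\<phi> \<in> iso (free_Abelian_group {1..n}) H"
    and basis: "\<And>l. l \<in> {1..n} \<Longrightarrow> \<phi> (frag_of l) = x l"
begin

abbreviation X where "X \<equiv> rep_set H m"

definition S where "S = {coord H m i j y | i j y. i \<in> {1..m} \<and> j \<in> {1..m} \<and> y \<in> carrier H}"

definition G where "G = {s_coord H m i j (x l) | i j l. i \<in> {1..m} \<and> j \<in> {1..m} \<and> l \<in> {1..n}}"

abbreviation V where "V \<equiv> rat_algebra_generated X S"

abbreviation J where "J \<equiv> J_ideal H m n x"

sublocale A: rational_function_algebra X V
  by unfold_locales (auto intro!: rat_subalgebra_generated simp: S_def coord_def)

lemma rep_ring_eq: "rep_ring H m = A.R"
  unfolding rep_ring_def S_def[symmetric] A.R_def by (rule refl)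

lemma J_eq: "J = Idl\<^bsub>A.R\<^esub> G"
  by (simp add: J_ideal_def rep_ring_eq G_def)

sublocale H: comm_group H by (rule comm_H)

sublocale \<phi>: group_hom "free_Abelian_group {1..n}" H \<phi>
  using iso by (auto simp: group_hom_def group_hom_axioms_def iso_def)

text \<open>The inverse of \<open>\<phi>\<close> gives the integer coordinates of a group element with respect to the basis.\<close>

definition \<psi> where "\<psi> = inv_into (carrier (free_Abelian_group {1..n})) \<phi>"

lemma \<psi>_mult:
  assumes "y \<in> carrier H" "z \<in> carrier H"
  shows "\<psi> (y \<otimes>\<^bsub>H\<^esub> z) = \<psi> y + \<psi> z"
  using hom_mult[of \<psi> H "free_Abelian_group {1..n}" y z] assms
    group.iso_set_sym[OF group_free_Abelian_group iso]
  by (simp add: iso_def \<psi>_def)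

lemma \<psi>_x: "l \<in> {1..n} \<Longrightarrow> \<psi> (x l) = frag_of l"
  using inv_into_f_f[of \<phi> "carrier (free_Abelian_group {1..n})" "frag_of l"] iso
  by (simp add: \<psi>_def basis[symmetric] iso_def bij_betw_def)

lemma x_carrier: "l \<in> {1..n} \<Longrightarrow> x l \<in> carrier H"
  using \<phi>.hom_closed[of "frag_of l"] by (simp add: basis)

lemma coord_V:
  assumes "i < m" "j < m" "y \<in> carrier H"
  shows "(\<lambda>\<rho>\<in>X. \<rho> y $$ (i, j)) \<in> V"
proof -
  have "coord H m (Suc i) (Suc j) y \<in> S"
    unfolding S_def using assms by fastforce
  then show ?thesis using rat_algebra_generated_incl[of S X] by (auto simp: coord_Suc)
qed

lemma G_V: "G \<subseteq> V"
proof
  fix g assume "g \<in> G"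
  then obtain i j l where g: "g = s_coord H m i j (x l)"
    and ij: "i \<in> {1..m}" "j \<in> {1..m}" and l: "l \<in> {1..n}" by (auto simp: G_def)
  obtain i' j' where ij': "i = Suc i'" "i' < m" "j = Suc j'" "j' < m"
    using ij one_based_index by metis
  have "(\<lambda>\<rho>\<in>X. \<rho> (x l) $$ (i', j') - of_rat (if i' = j' then 1 else 0)) \<in> V"
    using coord_V[OF ij'(2,4) x_carrier[OF l]] A.const_V[of "if i' = j' then 1 else 0"]
    by (intro A.ideal_diff A.ideal_V)
  then show "g \<in> V" by (simp add: g ij' s_coord_Suc split: if_splits)
qed

sublocale J: function_algebra_ideal X V J
  by (intro function_algebra_ideal.intro function_algebra_ideal_axioms.intro
      A.rational_function_algebra_axioms) (use G_V in \<open>simp add: J_eq A.R.genideal_ideal\<close>)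

lemma J_class_eq: "J_class H m n x = J.cls"
  by (simp add: fun_eq_iff J_class_def J_squared_def J.cls_def J.J2_def rep_ring_eq)

lemma gr1_eq: "gr1 H m n x = J.cotangent"
  by (simp add: gr1_def J.cotangent_def J_class_eq J_squared_def J.J2_def rep_ring_eq)

lemma s_coord_generator:
  assumes "i \<in> {1..m}" "j \<in> {1..m}" "l \<in> {1..n}"
  shows "s_coord H m i j (x l) \<in> J"
  using A.R.genideal_self[of G] G_V assms unfolding J_eq by (auto simp: G_def)

text \<open>Induction over the free abelian group with the step from \<open>a\<close> and \<open>b\<close> to \<open>a - b\<close>: multiplicativity
  of the representations gives \<open>S(a - b) = S(a) - A(a - b) S(b)\<close>, where the entries of \<open>A(a - b)\<close>
  belong to the algebra.\<close>

lemma s_coord_mem_J: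
  assumes "y \<in> carrier H" "i < m" "j < m"
  shows "(\<lambda>\<rho>\<in>X. \<rho> y $$ (i, j) - (if i = j then 1 else 0)) \<in> J"
proof -
  have "y \<in> \<phi> ` carrier (free_Abelian_group {1..n})"
    using assms(1) iso unfolding iso_def bij_betw_def by blast
  then obtain c where c: "y = \<phi> c" "Poly_Mapping.keys c \<subseteq> {1..n}"
    by (auto simp only: carrier_free_Abelian_group_iff image_iff)
  have "Poly_Mapping.keys c \<subseteq> {1..n} \<and>
      (\<forall>i<m. \<forall>j<m. (\<lambda>\<rho>\<in>X. \<rho> (\<phi> c) $$ (i, j) - (if i = j then 1 else 0)) \<in> J)"
    using c(2)
  proof (induction c rule: frag_induction)
    case zero
    have "(\<lambda>\<rho>\<in>X. \<rho> (\<phi> 0) $$ (i, j) - (if i = j then 1 else 0)) = (\<lambda>\<rho>\<in>X. 0)"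
      if "i < m" "j < m" for i j
      using \<phi>.hom_one that by (intro restrict_ext) (simp add: rep_set_one)
    then show ?case using A.ideal_zero[OF J.ideal_J] by simp
  next
    case (one l)
    have "(\<lambda>\<rho>\<in>X. \<rho> (x l) $$ (i, j) - (if i = j then 1 else 0)) \<in> J" if "i < m" "j < m" for i j
      using s_coord_generator[of "Suc i" "Suc j" l] that one by (simp only: s_coord_Suc) simp
    then show ?case using one by (simp add: basis)
  next
    case (diff a b)
    have keys: "Poly_Mapping.keys (a - b) \<subseteq> {1..n}"
      using diff keys_diff[of a b] by blast
    have ab: "\<phi> (a - b) \<in> carrier H" "\<phi> b \<in> carrier H"
      using \<phi>.hom_closed[of "a - b"] \<phi>.hom_closed[of b] keys diff by simp_all
    have "\<phi> a = \<phi> (a - b) \<otimes>\<^bsub>H\<^esub> \<phi> b"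
      using \<phi>.hom_mult[of "a - b" b] diff keys by simp
    then have mult: "\<rho> (\<phi> a) = \<rho> (\<phi> (a - b)) * \<rho> (\<phi> b)" if "\<rho> \<in> X" for \<rho>
      using rep_set_mult[OF that ab] by simp
    have "(\<lambda>\<rho>\<in>X. \<rho> (\<phi> (a - b)) $$ (i, j) - (if i = j then 1 else 0)) \<in> J"
      if ij: "i < m" "j < m" for i j
    proof -
      have "(\<lambda>\<rho>\<in>X. \<Sum>k<m. \<rho> (\<phi> (a - b)) $$ (i, k) * (\<rho> (\<phi> b) $$ (k, j) - (if k = j then 1 else 0))) \<in> J"
        using diff ij ab by (intro A.ideal_sum A.ideal_mult J.ideal_J coord_V) auto
      then have "(\<lambda>\<rho>\<in>X. (\<rho> (\<phi> a) $$ (i, j) - (if i = j then 1 else 0)) -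
          (\<Sum>k<m. \<rho> (\<phi> (a - b)) $$ (i, k) * (\<rho> (\<phi> b) $$ (k, j) - (if k = j then 1 else 0)))) \<in> J"
        by (rule A.ideal_diff[OF J.ideal_J, rotated]) (use diff ij in auto)
      moreover have "(\<rho> (\<phi> a) $$ (i, j) - (if i = j then 1 else 0)) -
          (\<Sum>k<m. \<rho> (\<phi> (a - b)) $$ (i, k) * (\<rho> (\<phi> b) $$ (k, j) - (if k = j then 1 else 0))) =
          \<rho> (\<phi> (a - b)) $$ (i, j) - (if i = j then 1 else 0)" if \<rho>: "\<rho> \<in> X" for \<rho>
      proof -
        have "\<rho> (\<phi> a) $$ (i, j) = (\<Sum>k<m. \<rho> (\<phi> (a - b)) $$ (i, k) * \<rho> (\<phi> b) $$ (k, j))"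
          using rep_set_carrier(1)[OF \<rho> ab(1)] rep_set_carrier(1)[OF \<rho> ab(2)] ij
          by (simp add: mult[OF \<rho>] scalar_prod_def lessThan_atLeast0)
        moreover have "(\<Sum>k<m. \<rho> (\<phi> (a - b)) $$ (i, k) * (if k = j then 1 else 0)) =
            \<rho> (\<phi> (a - b)) $$ (i, j)" using ij by (simp add: if_distrib[of "(*) _"] cong: if_cong)
        ultimately show ?thesis by (simp add: right_diff_distrib sum_subtractf)
      qed
      ultimately show ?thesis by simp
    qed
    with keys show ?case by blast
  qed
  then show ?thesis using assms c by blast
qed

lemma scalar_mod_J:
  assumes "f \<in> V"
  shows "\<exists>q. (\<lambda>\<rho>\<in>X. f \<rho> - of_rat q) \<in> J"
proof (rule J.scalar_mod_J[OF refl _ assms])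
  fix f assume "f \<in> S"
  then obtain i j y where f: "f = coord H m i j y" "i \<in> {1..m}" "j \<in> {1..m}" "y \<in> carrier H"
    by (auto simp: S_def)
  obtain i' j' where ij': "i = Suc i'" "i' < m" "j = Suc j'" "j' < m"
    using f one_based_index by metis
  show "\<exists>q. (\<lambda>\<rho>\<in>X. f \<rho> - of_rat q) \<in> J"
    using s_coord_mem_J[OF f(4) ij'(2,4)]
    by (intro exI[of _ "if i' = j' then 1 else 0"]) (simp add: f ij' coord_Suc split: if_splits)
qed

definition T1 where "T1 = (\<lambda>(i, j, l). s_coord H m i j (x l))"

lemma finite_T1_index: "finite (T1_index m n)"
  by (rule finite_subset[of _ "{1..m} \<times> {1..m} \<times> {1..n}"]) (auto simp: T1_index_def)

lemma T1_mem_J: "q \<in> T1_index m n \<Longrightarrow> T1 q \<in> J"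
  by (auto simp: T1_def T1_index_def intro: s_coord_generator)

text \<open>For each \<open>x\<^sub>l\<close> one generator is outside the family, the one at \<open>(m, m)\<close>; it is the trace, which
  is of second order, minus the other diagonal entries.\<close>

lemma generator_span:
  assumes "g \<in> G"
  shows "\<exists>c. (\<lambda>\<rho>\<in>X. g \<rho> - (\<Sum>q\<in>T1_index m n. of_rat (c q) * T1 q \<rho>)) \<in> J.J2"
proof -
  obtain i j l where g: "g = s_coord H m i j (x l)" "i \<in> {1..m}" "j \<in> {1..m}" "l \<in> {1..n}"
    using assms by (auto simp: G_def)
  show ?thesis
  proof (cases "(i, j) = (m, m)")
    case False
    let ?c = "\<lambda>q. if q = (i, j, l) then 1 else 0 :: rat"
    have q: "(i, j, l) \<in> T1_index m n" using g False by (auto simp: T1_index_def)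
    have "(\<Sum>q\<in>T1_index m n. of_rat (?c q) * T1 q \<rho>) =
        (\<Sum>q\<in>T1_index m n. if q = (i, j, l) then T1 q \<rho> else 0)" for \<rho>
      by (rule sum.cong) auto
    then have "(\<Sum>q\<in>T1_index m n. of_rat (?c q) * T1 q \<rho>) = g \<rho>" for \<rho>
      using q finite_T1_index by (simp add: T1_def g(1))
    then show ?thesis using A.ideal_zero[OF J.ideal_J2] by (intro exI[of _ ?c]) simp
  next
    case True
    let ?D = "(\<lambda>i. (i, i, l)) ` {1..<m}"
    let ?c = "\<lambda>q. if q \<in> ?D then -1 else 0 :: rat"
    have D: "?D \<subseteq> T1_index m n" using g by (auto simp: T1_index_def)
    have inj: "inj_on (\<lambda>i. (i, i, l)) {1..<m}" by (auto simp: inj_on_def)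
    have m: "m \<ge> 1" using g by auto
    have eq: "g \<rho> - (\<Sum>q\<in>T1_index m n. of_rat (?c q) * T1 q \<rho>) = (\<Sum>i<m. \<rho> (x l) $$ (i, i) - 1)"
      if \<rho>: "\<rho> \<in> X" for \<rho>
    proof -
      have "(\<Sum>q\<in>T1_index m n. of_rat (?c q) * T1 q \<rho>) = (\<Sum>q\<in>?D. of_rat (?c q) * T1 q \<rho>)"
        by (rule sum.mono_neutral_right[OF finite_T1_index D]) auto
      also have "\<dots> = (\<Sum>q\<in>?D. - T1 q \<rho>)" by (rule sum.cong) auto
      also have "\<dots> = (\<Sum>i\<in>{1..<m}. - T1 (i, i, l) \<rho>)" by (simp only: sum.reindex[OF inj] comp_def)
      finally have "g \<rho> - (\<Sum>q\<in>T1_index m n. of_rat (?c q) * T1 q \<rho>) =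
          T1 (m, m, l) \<rho> + (\<Sum>i\<in>{1..<m}. T1 (i, i, l) \<rho>)"
        using True by (simp add: g(1) T1_def sum_negf)
      also have "\<dots> = (\<Sum>i\<in>{1..<Suc m}. T1 (i, i, l) \<rho>)" using m by simp
      also have "\<dots> = (\<Sum>i<m. T1 (Suc i, Suc i, l) \<rho>)"
        using sum.shift_bounds_Suc_ivl[of "\<lambda>i. T1 (i, i, l) \<rho>" 0 m] by (simp add: lessThan_atLeast0)
      finally show ?thesis using \<rho> by (simp add: T1_def s_coord_Suc)
    qed
    have "(\<lambda>\<rho>\<in>X. \<Sum>i<m. \<rho> (x l) $$ (i, i) - 1) \<in> J.J2"
      using x_carrier[OF g(4)]
      by (intro J.trace_mem_J2 rep_set_carrier s_coord_mem_J) auto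
    then show ?thesis using eq by (intro exI[of _ ?c]) (simp cong: restrict_cong)
  qed
qed

text \<open>The representation that sends the basis element \<open>x\<^sub>l\<close> to \<open>1 + t N\<close> and the others to \<open>1\<close>, provided
  that \<open>N\<close> has square zero. The exponent of \<open>x\<^sub>l\<close> enters as a factor of \<open>t\<close> because
  \<open>(1 + t N)\<^sup>k = 1 + t k N\<close>.\<close>

definition curve :: "nat \<Rightarrow> complex mat \<Rightarrow> complex \<Rightarrow> 'h \<Rightarrow> complex mat" where
  "curve l N t = (\<lambda>y\<in>carrier H. 1\<^sub>m m + (t * of_int (poly_mapping.lookup (\<psi> y) l)) \<cdot>\<^sub>m N)"

lemma curve_rep:
  assumes N: "N \<in> carrier_mat m m" "N * N = 0\<^sub>m m m"
  shows "curve l N t \<in> X"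
proof -
  have "curve l N t \<in> hom H (SL m)"
  proof (rule homI)
    fix y assume "y \<in> carrier H"
    then show "curve l N t y \<in> carrier (SL m)"
      using N det_one_plus_square_zero[OF N] by (simp add: curve_def SL_def)
  next
    fix y z assume yz: "y \<in> carrier H" "z \<in> carrier H"
    then show "curve l N t (y \<otimes>\<^bsub>H\<^esub> z) = curve l N t y \<otimes>\<^bsub>SL m\<^esub> curve l N t z"
      using mult_one_plus_square_zero[OF N]
      by (simp add: curve_def SL_def \<psi>_mult lookup_add distrib_left)
  qed
  then show ?thesis by (simp add: rep_set_def curve_def)
qed

lemma curve_entry:
  assumes N: "N \<in> carrier_mat m m" "y \<in> carrier H" "i < m" "j < m"
  shows "curve l N t y $$ (i, j) =
    (if i = j then 1 else 0) + t * of_int (poly_mapping.lookup (\<psi> y) l) * N $$ (i, j)"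
  using assms by (simp add: curve_def)

lemma J2_deriv_curve:
  assumes N: "N \<in> carrier_mat m m" "N * N = 0\<^sub>m m m" and f: "f \<in> J.J2"
  shows "((\<lambda>t. f (curve l N t)) has_field_derivative 0) (at 0)"
proof (rule J.J2_deriv_zero[OF curve_rep[OF N] _ _ f])
  fix f assume f: "f \<in> V"
  show "\<exists>d. ((\<lambda>t. f (curve l N t)) has_field_derivative d) (at 0)"
  proof (rule J.differentiable_generated[OF curve_rep[OF N] refl _ f])
    fix f assume "f \<in> S"
    then obtain i j y where f: "f = coord H m i j y" "i \<in> {1..m}" "j \<in> {1..m}" "y \<in> carrier H"
      by (auto simp: S_def)
    obtain i' j' where ij': "i = Suc i'" "i' < m" "j = Suc j'" "j' < m"
      using f one_based_index by metis
    have "f (curve l N t) =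
        (if i' = j' then 1 else 0) + t * of_int (poly_mapping.lookup (\<psi> y) l) * N $$ (i', j')" for t
      using f ij' curve_rep[OF N] by (simp add: coord_Suc curve_entry[OF N(1)])
    moreover have "((\<lambda>t. a + t * b * c) has_field_derivative b * c) (at 0)" for a b c :: complex
      by (auto intro!: derivative_eq_intros)
    ultimately show "\<exists>d. ((\<lambda>t. f (curve l N t)) has_field_derivative d) (at 0)"
      by (simp only:) blast
  qed
next
  fix f assume "f \<in> J"
  then show "f (curve l N 0) = 0"
  proof (rule J.vanish_generated[OF J_eq G_V curve_rep[OF N], rotated])
    fix g assume "g \<in> G"
    then obtain i j k where g: "g = s_coord H m i j (x k)"
      and ij: "i \<in> {1..m}" "j \<in> {1..m}" and k: "k \<in> {1..n}" by (auto simp: G_def)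
    obtain i' j' where ij': "i = Suc i'" "i' < m" "j = Suc j'" "j' < m"
      using ij one_based_index by metis
    show "g (curve l N 0) = 0"
      using curve_rep[OF N] ij' x_carrier[OF k] by (simp add: g s_coord_Suc curve_entry[OF N(1)])
  qed
qed

text \<open>A relation between the classes, differentiated along the curve in direction \<open>N\<close>, becomes a linear
  equation for the coefficients that belong to \<open>x\<^sub>l\<close>.\<close>

lemma J2_tangent:
  fixes N :: "complex mat"
  assumes N: "N \<in> carrier_mat m m" "N * N = 0\<^sub>m m m"
    and f: "(\<lambda>\<rho>\<in>X. \<Sum>q\<in>T1_index m n. of_rat (c q) * T1 q \<rho>) \<in> J.J2"
  shows "(\<Sum>(i, j, k)\<in>T1_index m n. if k = l then of_rat (c (i, j, k)) * N $$ (i - 1, j - 1) else 0) = 0"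
proof -
  have T1: "T1 (i, j, k) (curve l N t) = (if k = l then N $$ (i - 1, j - 1) else 0) * t"
    if q: "(i, j, k) \<in> T1_index m n" for i j k t
  proof -
    have k: "k \<in> {1..n}" "i \<in> {1..m}" "j \<in> {1..m}" using q by (auto simp: T1_index_def)
    obtain i' j' where ij': "i = Suc i'" "i' < m" "j = Suc j'" "j' < m"
      using k one_based_index by metis
    show ?thesis using curve_rep[OF N] ij' x_carrier[OF k(1)]
      by (simp add: T1_def s_coord_Suc curve_entry[OF N(1)] \<psi>_x[OF k(1)] mult.commute)
  qed
  let ?D = "\<Sum>(i, j, k)\<in>T1_index m n. if k = l then of_rat (c (i, j, k)) * N $$ (i - 1, j - 1) else 0"
  have "(\<Sum>q\<in>T1_index m n. of_rat (c q) * T1 q (curve l N t)) = ?D * t" for t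
    unfolding sum_distrib_right by (rule sum.cong) (auto simp: T1)
  then have "((\<lambda>t. ?D * t) has_field_derivative 0) (at 0)"
    using J2_deriv_curve[OF N f, of l] curve_rep[OF N] by simp
  moreover have "((\<lambda>t. ?D * t) has_field_derivative ?D) (at 0)"
    by (auto intro!: derivative_eq_intros)
  ultimately show ?thesis using DERIV_unique by blast
qed

text \<open>Direction \<open>N = e\<^sub>i e\<^sub>j\<^sup>T\<close> for \<open>i \<noteq> j\<close> isolates an off-diagonal coefficient. A single diagonal
  matrix unit does not have square zero; the direction \<open>(e\<^sub>i + e\<^sub>m)(e\<^sub>i - e\<^sub>m)\<^sup>T\<close> does, and of its
  nonzero entries only the one at \<open>(i, i)\<close> meets a coefficient that is not known to vanish: two are
  off the diagonal and the last is at \<open>(m, m)\<close>, which does not occur in the family.\<close>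

lemma T1_independent:
  assumes f: "(\<lambda>\<rho>\<in>X. \<Sum>q\<in>T1_index m n. of_rat (c q) * T1 q \<rho>) \<in> J.J2"
    and q: "q \<in> T1_index m n"
  shows "c q = 0"
proof -
  \<comment> \<open>a direction all of whose entries but one meet vanishing coefficients\<close>
  have single: "c (i, j, l) = 0"
    if ij: "(i, j, l) \<in> T1_index m n" and N: "N \<in> carrier_mat m m" "N * N = 0\<^sub>m m m"
      "N $$ (i - 1, j - 1) = 1"
      and others: "\<And>i' j'. (i', j', l) \<in> T1_index m n \<Longrightarrow> (i', j') \<noteq> (i, j) \<Longrightarrow>
        c (i', j', l) = 0 \<or> N $$ (i' - 1, j' - 1) = 0" for i j l and N :: "complex mat"
  proof -
    let ?F = "\<lambda>(i, j, k). if k = l then of_rat (c (i, j, k)) * N $$ (i - 1, j - 1) else 0"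
    have "sum ?F (T1_index m n) = ?F (i, j, l) + sum ?F (T1_index m n - {(i, j, l)})"
      by (rule sum.remove[OF finite_T1_index ij])
    also have "sum ?F (T1_index m n - {(i, j, l)}) = 0"
    proof (rule sum.neutral, rule ballI)
      fix q assume q: "q \<in> T1_index m n - {(i, j, l)}"
      obtain i' j' k where "q = (i', j', k)" by (cases q)
      with q others[of i' j'] show "?F q = 0" by auto
    qed
    finally show ?thesis using J2_tangent[OF N(1,2) f, of l] N(3) by simp
  qed
  \<comment> \<open>direction \<open>e\<^sub>i e\<^sub>j\<^sup>T\<close>, with 0-based matrix indices\<close>
  have off: "c (i, j, l) = 0" if ij: "(i, j, l) \<in> T1_index m n" "i \<noteq> j" for i j l
  proof -
    let ?u = "\<lambda>a. if a = i - 1 then 1 else 0 :: complex"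
    let ?v = "\<lambda>b. if b = j - 1 then 1 else 0 :: complex"
    have r: "i \<in> {1..m}" "j \<in> {1..m}" using ij by (auto simp: T1_index_def)
    show ?thesis
    proof (rule single[OF ij(1), of "mat m m (\<lambda>(a, b). ?u a * ?v b)"])
      show "mat m m (\<lambda>(a, b). ?u a * ?v b) * mat m m (\<lambda>(a, b). ?u a * ?v b) = 0\<^sub>m m m"
        by (rule rank_one_square_zero) (use r ij in \<open>auto intro!: sum.neutral\<close>)
    qed (use r in \<open>auto simp: T1_index_def split: if_splits\<close>)
  qed
  \<comment> \<open>direction \<open>(e\<^sub>i + e\<^sub>m)(e\<^sub>i - e\<^sub>m)\<^sup>T\<close>\<close>
  have diag: "c (i, i, l) = 0" if i: "(i, i, l) \<in> T1_index m n" for i l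
  proof -
    let ?u = "\<lambda>a. if a = i - 1 \<or> a = m - 1 then 1 else 0 :: complex"
    let ?v = "\<lambda>b. if b = i - 1 then 1 else if b = m - 1 then -1 else 0 :: complex"
    have r: "i \<in> {1..m}" "i \<noteq> m" using i by (auto simp: T1_index_def)
    show ?thesis
    proof (rule single[OF i, of "mat m m (\<lambda>(a, b). ?u a * ?v b)"])
      have "(\<Sum>k<m. ?v k * ?u k) = (\<Sum>k\<in>{i - 1, m - 1}. ?v k * ?u k)"
        by (rule sum.mono_neutral_right) (use r in auto)
      also have "\<dots> = 0" using r by (subst sum.insert) auto
      finally show "mat m m (\<lambda>(a, b). ?u a * ?v b) * mat m m (\<lambda>(a, b). ?u a * ?v b) = 0\<^sub>m m m"
        by (rule rank_one_square_zero)
    next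
      fix i' j' assume ij': "(i', j', l) \<in> T1_index m n" "(i', j') \<noteq> (i, i)"
      show "c (i', j', l) = 0 \<or> mat m m (\<lambda>(a, b). ?u a * ?v b) $$ (i' - 1, j' - 1) = 0"
      proof (cases "i' = j'")
        case False
        then show ?thesis using off ij' by blast
      next
        case True
        then have "i' - 1 \<noteq> i - 1" "i' - 1 \<noteq> m - 1" "i' - 1 < m" "j' = i'"
          using ij' r by (auto simp: T1_index_def)
        then show ?thesis by simp
      qed
    qed (use r in auto)
  qed
  show ?thesis using off diag q by (cases q) metis
qed

lemma gr1_basis:
  "inj_on (\<lambda>q. J.cls (T1 q)) (T1_index m n)"
  "vectorspace.basis (class_ring :: rat ring) J.cotangent ((\<lambda>q. J.cls (T1 q)) ` T1_index m n)"
proof -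
  have span: "\<exists>c. (\<lambda>\<rho>\<in>X. f \<rho> - (\<Sum>q\<in>T1_index m n. of_rat (c q) * T1 q \<rho>)) \<in> J.J2"
    if "f \<in> J" for f
    by (rule J.span_mod_J2[OF J_eq G_V scalar_mod_J T1_mem_J generator_span that])
  show "inj_on (\<lambda>q. J.cls (T1 q)) (T1_index m n)"
    by (rule J.basis_cotangentI(1)) (fact finite_T1_index T1_mem_J span T1_independent)+
  show "vectorspace.basis (class_ring :: rat ring) J.cotangent
      ((\<lambda>q. J.cls (T1 q)) ` T1_index m n)"
    by (rule J.basis_cotangentI(2)) (fact finite_T1_index T1_mem_J span T1_independent)+
qed

end

theorem proposition7p1:
  fixes H :: "('h, 'b) monoid_scheme" and x :: "nat \<Rightarrow> 'h" and m n :: nat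
  assumes "m \<ge> 2"
    and "free_abelian_basis H {1..n} x"
  shows "vectorspace (class_ring :: rat ring) (gr1 H m n x) \<and>
    inj_on (\<lambda>(i, j, l). J_class H m n x (s_coord H m i j (x l))) (T1_index m n) \<and>
    vectorspace.basis (class_ring :: rat ring) (gr1 H m n x)
      ((\<lambda>(i, j, l). J_class H m n x (s_coord H m i j (x l))) ` T1_index m n)"
proof -
  obtain \<phi> where "comm_group H" "\<phi> \<in> iso (free_Abelian_group {1..n}) H"
    "\<forall>l\<in>{1..n}. \<phi> (frag_of l) = x l"
    using assms(2) by (auto simp: free_abelian_basis_def)
  then interpret free_abelian_representations H m n x \<phi>
    by (intro free_abelian_representations.intro) auto
  have "(\<lambda>(i, j, l). J_class H m n x (s_coord H m i j (x l))) = (\<lambda>q. J.cls (T1 q))"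
    by (auto simp: T1_def J_class_eq)
  then show ?thesis using J.vectorspace_cotangent gr1_basis by (simp add: gr1_eq)
qed

end
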